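(* Let $h\ge 2$ and $n=2h$. Among all Hamiltonian chain graphs of order $n$, the minimum number of Hamilton cycles is $2^{h-2}$, and this minimum is attained, uniquely up to isomorphism, by the chain graph $G_n$ generated by the binary sequence $0\,0\,(1\,0)^{h-2}\,1\,1$ (i.e. $(0^21)(01)\cdots(01)(01^2)$ with $h-1$ blocks when $h\ge3$, and $0^21^2$ when $h=2$).
   Context: For a binary sequence $b=(b_1\cdots b_n)$ the chain graph generated by $b$ has vertex set $\{1,\dots,n\}$, and for $i<j$ the vertices $i,j$ are adjacent iff $b_i=0$ and $b_j=1$; a chain graph is a graph isomorphic to one so generated. A Hamilton cycle is a cycle (as a subgraph) passing through all vertices; a graph is Hamiltonian if it has one. The number of Hamilton cycles counts distinct cycle subgraphs. *)

theory Defs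
  imports "HOL-Library.Z2"
begin

record 'a ugraph =
  verts :: "'a set"
  edges :: "'a set set"

definition simple_graph :: "'a ugraph \<Rightarrow> bool" where
  "simple_graph G \<longleftrightarrow> finite (verts G) \<and> (\<forall>e\<in>edges G. e \<subseteq> verts G \<and> card e = 2)"

definition graph_order :: "'a ugraph \<Rightarrow> nat" where
  "graph_order G = card (verts G)"

definition graph_iso :: "'a ugraph \<Rightarrow> 'b ugraph \<Rightarrow> bool" where
  "graph_iso G H \<longleftrightarrow>
    (\<exists>f. bij_betw f (verts G) (verts H) \<and>
      (\<forall>u\<in>verts G. \<forall>v\<in>verts G. {u, v} \<in> edges G \<longleftrightarrow> {f u, f v} \<in> edges H))"

definition subgraph :: "'a ugraph \<Rightarrow> 'a ugraph \<Rightarrow> bool" where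
  "subgraph H G \<longleftrightarrow> verts H \<subseteq> verts G \<and> edges H \<subseteq> edges G"

text \<open>Vertices are numbered from 1, whereas lists are indexed from 0.\<close>

definition chain_graph_of :: "bit list \<Rightarrow> nat ugraph" where
  "chain_graph_of b =
    \<lparr> verts = {1..length b},
      edges = {{i, j} | i j. 1 \<le> i \<and> i < j \<and> j \<le> length b \<and>
                             b ! (i - 1) = 0 \<and> b ! (j - 1) = 1} \<rparr>"

definition chain_graph :: "'a ugraph \<Rightarrow> bool" where
  "chain_graph G \<longleftrightarrow> simple_graph G \<and> (\<exists>b. graph_iso G (chain_graph_of b))"

definition is_cycle :: "'a ugraph \<Rightarrow> bool" where
  "is_cycle C \<longleftrightarrow>
    (\<exists>vs. distinct vs \<and> length vs \<ge> 3 \<and> verts C = set vs \<and>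
      edges C = {{vs ! i, vs ! ((i + 1) mod length vs)} | i. i < length vs})"

text \<open>Hamilton cycles are subgraphs, not vertex sequences: the starting point and
  the direction of traversal do not matter when counting them.\<close>

definition hamilton_cycles :: "'a ugraph \<Rightarrow> 'a ugraph set" where
  "hamilton_cycles G = {C. subgraph C G \<and> is_cycle C \<and> verts C = verts G}"

definition hamiltonian :: "'a ugraph \<Rightarrow> bool" where
  "hamiltonian G \<longleftrightarrow> hamilton_cycles G \<noteq> {}"

definition num_hamilton_cycles :: "'a ugraph \<Rightarrow> nat" where
  "num_hamilton_cycles G = card (hamilton_cycles G)"

text \<open>The parameter is half the order: the graph $G_n$ with $n = 2h$ is
  \<open>extremal_graph h\<close>.\<close>

definition extremal_graph :: "nat \<Rightarrow> nat ugraph" where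
  "extremal_graph h =
    chain_graph_of ([0, 0] @ concat (replicate (h - 2) [1, 0]) @ [1, 1])"

end

theory Submission
  imports Defs
begin

text \<open>In a Hamiltonian chain graph the first vertex \<open>r\<close> is a zero adjacent to every one, so
  deleting \<open>r\<close> turns each Hamilton cycle into two alternating paths (one per direction) through
  the remaining vertices, starting and ending in ones. In such a path the last zero \<open>x\<close> occurs as
  \<open>y x y'\<close>, and all ones in the neighbourhood of \<open>x\<close> are adjacent to every other zero, so the
  segment can be contracted to \<open>y\<close>. If \<open>x\<close> has \<open>c\<close> neighbours left, there are \<open>c (c - 1)\<close> choices
  for \<open>(y, y')\<close>. Twice the number of Hamilton cycles is therefore a product of \<open>h - 1\<close> factors
  \<open>c (c - 1)\<close>; each is at least 2 when the product is nonzero, and all of them equal 2 only for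
  the sequence \<open>0 0 (1 0)^(h-2) 1 1\<close>.\<close>

section \<open>Paths as vertex lists and their edge sets\<close>

fun path_edges :: "'a list \<Rightarrow> 'a set set" where
  "path_edges [] = {}"
| "path_edges [x] = {}"
| "path_edges (x # y # zs) = insert {x, y} (path_edges (y # zs))"

lemma path_edges_append:
  "path_edges (as @ x # bs) = path_edges (as @ [x]) \<union> path_edges (x # bs)"
  by (induction as rule: path_edges.induct) auto

lemma path_edges_Cons: "p \<noteq> [] \<Longrightarrow> path_edges (x # p) = insert {x, hd p} (path_edges p)"
  by (cases p) auto

lemma path_edges_snoc: "p \<noteq> [] \<Longrightarrow> path_edges (p @ [x]) = insert {last p, x} (path_edges p)"
  by (induction p rule: path_edges.induct) auto

lemma path_edges_rev: "path_edges (rev p) = path_edges p"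
proof (induction p)
  case (Cons x p)
  then show ?case
    by (cases "p = []")
       (auto simp: path_edges_snoc path_edges_Cons last_rev insert_commute)
qed simp

lemma path_edges_subset: "e \<in> path_edges p \<Longrightarrow> e \<subseteq> set p"
  by (induction p rule: path_edges.induct) auto

lemma path_edges_nth: "path_edges p = {{p ! i, p ! Suc i} | i. Suc i < length p}"
proof (induction p rule: path_edges.induct)
  case (3 x y zs)
  have *: "{{(x # y # zs) ! i, (x # y # zs) ! Suc i} | i. Suc i < length (x # y # zs)}
     = insert {x, y} {{(y # zs) ! i, (y # zs) ! Suc i} | i. Suc i < length (y # zs)}"
    (is "?L = insert _ ?R")
  proof (intro equalityI subsetI)
    fix e assume "e \<in> ?L"
    then obtain i where i: "e = {(x # y # zs) ! i, (x # y # zs) ! Suc i}"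
      "Suc i < length (x # y # zs)" by blast
    show "e \<in> insert {x, y} ?R"
      using i by (cases i) auto
  next
    fix e assume "e \<in> insert {x, y} ?R"
    then consider "e = {x, y}" | i where "e = {(y # zs) ! i, (y # zs) ! Suc i}"
      "Suc i < length (y # zs)" by blast
    then show "e \<in> ?L"
    proof cases
      case 1
      then show ?thesis by (intro CollectI exI[of _ 0]) auto
    next
      case (2 i)
      then show ?thesis by (intro CollectI exI[of _ "Suc i"]) auto
    qed
  qed
  show ?case unfolding path_edges.simps(3) 3 * ..
qed auto

lemma successively_iff_path_edges:
  "successively (\<lambda>u v. {u, v} \<in> A) p \<longleftrightarrow> path_edges p \<subseteq> A"
  by (induction p rule: path_edges.induct) auto

text \<open>The first vertex lies on only one edge of a path, and that edge names the second vertex.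
  Deleting the first vertex removes exactly this edge, so the tails satisfy the same assumptions.
  The common head is what excludes the reversed list, which has the same edges.\<close>

lemma path_edges_determine_path:
  assumes "distinct p" "distinct q" "set p = set q" "hd p = hd q" "path_edges p = path_edges q"
  shows "p = q"
  using assms
proof (induction p arbitrary: q rule: path_edges.induct)
  case 1
  then show ?case by simp
next
  case (2 x)
  then have "length q = 1" by (metis distinct_card length_Cons list.size(3) One_nat_def)
  with 2 show ?case by (cases q) auto
next
  case (3 a b ps)
  have "length q = length (a # b # ps)"
    using 3 by (metis distinct_card)
  then obtain c qs where q: "q = a # c # qs"
    using 3(5) by (cases q; cases "tl q") auto
  have a: "a \<notin> e" if "e \<in> path_edges (b # ps) \<or> e \<in> path_edges (c # qs)" for e
    using that 3(2,3) path_edges_subset[of e "b # ps"] path_edges_subset[of e "c # qs"]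
    unfolding q by auto
  have eq: "insert {a, b} (path_edges (b # ps)) = insert {a, c} (path_edges (c # qs))"
    using 3(6) by (simp add: q)
  have "{a, b} = {a, c}" using eq a[of "{a, b}"] by blast
  then have "b = c" by (auto simp: doubleton_eq_iff)
  moreover have "path_edges (b # ps) = path_edges (c # qs)"
  proof (intro equalityI subsetI)
    fix e assume e: "e \<in> path_edges (b # ps)"
    then show "e \<in> path_edges (c # qs)" using eq a[of e] by blast
  next
    fix e assume e: "e \<in> path_edges (c # qs)"
    then show "e \<in> path_edges (b # ps)" using eq a[of e] by blast
  qed
  moreover have "set (b # ps) = set (c # qs)"
    using 3(2-4) unfolding q by auto
  ultimately have "b # ps = c # qs"
    using 3 unfolding q by (intro "3.IH") auto
  then show ?case by (simp add: q)
qed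

section \<open>Cycles cut open at a root vertex\<close>

text \<open>The root is kept out of \<open>p\<close>: once the starting point is fixed, the
  direction is the only freedom left in writing a cycle as a list.\<close>

definition cycle_graph :: "'a \<Rightarrow> 'a list \<Rightarrow> 'a ugraph" where
  "cycle_graph r p = \<lparr> verts = set (r # p), edges = path_edges (r # p @ [r]) \<rparr>"

lemma cyclic_nth_edges:
  assumes "vs \<noteq> []"
  shows "{{vs ! i, vs ! ((i + 1) mod length vs)} | i. i < length vs} = path_edges (vs @ [hd vs])"
proof -
  have *: "vs ! i = (vs @ [hd vs]) ! i \<and> vs ! ((i + 1) mod length vs) = (vs @ [hd vs]) ! Suc i"
    if "i < length vs" for i
  proof (cases "Suc i = length vs")
    case True
    then show ?thesis using assms by (simp add: nth_append hd_conv_nth)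
  next
    case False
    then show ?thesis using that by (simp add: nth_append)
  qed
  have "{{vs ! i, vs ! ((i + 1) mod length vs)} | i. i < length vs}
    = {{(vs @ [hd vs]) ! i, (vs @ [hd vs]) ! Suc i} | i. i < length vs}"
    by (intro Collect_cong ex_cong1) (metis *)
  then show ?thesis by (simp add: path_edges_nth)
qed

text \<open>A cyclic vertex list can be rotated until it begins with any prescribed vertex
  \<open>r\<close>.\<close>

lemma is_cycle_iff_cycle_graph:
  assumes "r \<in> verts C"
  shows "is_cycle C \<longleftrightarrow> (\<exists>p. distinct (r # p) \<and> 2 \<le> length p \<and> C = cycle_graph r p)"
proof
  assume "is_cycle C"
  then obtain vs where vs: "distinct vs" "3 \<le> length vs" "verts C = set vs"
      "edges C = {{vs ! i, vs ! ((i + 1) mod length vs)} | i. i < length vs}"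
    unfolding is_cycle_def by blast
  then have e: "edges C = path_edges (vs @ [hd vs])"
    by (subst cyclic_nth_edges[symmetric]) auto
  obtain as bs where s: "vs = as @ r # bs" using assms vs(3) by (metis split_list)
  \<comment> \<open>Both closed walks are cut at \<open>r\<close> and at the old starting vertex,
    which yields the same two arcs in opposite order. If \<open>as\<close> is empty, the list
    already starts at \<open>r\<close>.\<close>
  have "path_edges (vs @ [hd vs]) = path_edges (r # (bs @ as) @ [r])"
  proof (cases as)
    case (Cons a as')
    show ?thesis
      using path_edges_append[of "a # as'" r "bs @ [a]"] path_edges_append[of "r # bs" a "as' @ [r]"]
      by (auto simp: s Cons)
  qed (simp add: s)
  then have "C = cycle_graph r (bs @ as)"
    using e vs(3) by (cases C) (auto simp: cycle_graph_def s)
  moreover have "distinct (r # bs @ as)" "2 \<le> length (bs @ as)" using vs(1,2) by (auto simp: s)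
  ultimately show "\<exists>p. distinct (r # p) \<and> 2 \<le> length p \<and> C = cycle_graph r p" by blast
next
  assume "\<exists>p. distinct (r # p) \<and> 2 \<le> length p \<and> C = cycle_graph r p"
  then obtain p where p: "distinct (r # p)" "2 \<le> length p" "C = cycle_graph r p" by blast
  then show "is_cycle C" unfolding is_cycle_def
    by (intro exI[of _ "r # p"]) (subst cyclic_nth_edges, auto simp: cycle_graph_def)
qed

lemma cycle_edges:
  assumes "p \<noteq> []"
  shows "path_edges (r # p @ [r]) = insert {r, hd p} (insert {r, last p} (path_edges p))"
  using assms by (simp add: path_edges_Cons path_edges_snoc insert_commute)

lemma path_edges_cycle_rev: "path_edges (r # rev p @ [r]) = path_edges (r # p @ [r])"
  using path_edges_rev[of "r # p @ [r]"] by simp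

text \<open>Edges avoiding \<open>r\<close> are those of the open path, so equal cycles have equal
  path edges. The edges at \<open>r\<close> show that \<open>q\<close> starts at one of the two ends
  of \<open>p\<close>; after reversing \<open>p\<close> if necessary,
  \<open>path_edges_determine_path\<close> applies.\<close>

lemma cycle_graph_eq_iff:
  assumes "distinct (r # p)" "2 \<le> length p" "distinct (r # q)" "2 \<le> length q"
  shows "cycle_graph r q = cycle_graph r p \<longleftrightarrow> q = p \<or> q = rev p"
proof
  assume eq: "cycle_graph r q = cycle_graph r p"
  have ne: "p \<noteq> []" "q \<noteq> []" using assms by auto
  have r: "r \<notin> e" if "e \<in> path_edges p \<or> e \<in> path_edges q" for e
    using that assms(1,3) path_edges_subset[of e p] path_edges_subset[of e q] by auto
  have set: "set q = set p" using eq assms by (auto simp: cycle_graph_def)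
  have E: "insert {r, hd q} (insert {r, last q} (path_edges q))
         = insert {r, hd p} (insert {r, last p} (path_edges p))"
    using eq ne by (simp add: cycle_graph_def cycle_edges del: append_Cons)
  have pe: "path_edges q = path_edges p"
  proof (intro equalityI subsetI)
    fix e assume "e \<in> path_edges p"
    then show "e \<in> path_edges q" using E r[of e] by blast
  next
    fix e assume "e \<in> path_edges q"
    then show "e \<in> path_edges p" using E r[of e] by blast
  qed
  have "{r, hd q} \<in> {{r, hd p}, {r, last p}}"
    using E r[of "{r, hd q}"] by blast
  then have "hd q = hd p \<or> hd q = hd (rev p)"
    using ne by (auto simp: doubleton_eq_iff hd_rev)
  then show "q = p \<or> q = rev p"
    using path_edges_determine_path[of q p] path_edges_determine_path[of q "rev p"] pe set assms
    by (auto simp: path_edges_rev)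
next
  assume "q = p \<or> q = rev p"
  then show "cycle_graph r q = cycle_graph r p"
    by (auto simp: cycle_graph_def path_edges_cycle_rev)
qed

text \<open>These lists encode Hamilton cycles together with a direction of traversal, hence every
  cycle twice.\<close>

definition rooted_cycles :: "'a ugraph \<Rightarrow> 'a \<Rightarrow> 'a list set" where
  "rooted_cycles G r =
    {p. distinct (r # p) \<and> 2 \<le> length p \<and> set (r # p) = verts G \<and> path_edges (r # p @ [r]) \<subseteq> edges G}"

lemma hamilton_cycles_eq_image:
  assumes "r \<in> verts G"
  shows "hamilton_cycles G = cycle_graph r ` rooted_cycles G r"
proof (intro equalityI subsetI)
  fix C assume C: "C \<in> hamilton_cycles G"
  then obtain p where "distinct (r # p)" "2 \<le> length p" "C = cycle_graph r p"
    using is_cycle_iff_cycle_graph[of r C] assms by (auto simp: hamilton_cycles_def)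
  with C show "C \<in> cycle_graph r ` rooted_cycles G r"
    by (auto simp: hamilton_cycles_def rooted_cycles_def subgraph_def cycle_graph_def)
next
  fix C assume "C \<in> cycle_graph r ` rooted_cycles G r"
  then obtain p where p: "p \<in> rooted_cycles G r" "C = cycle_graph r p" by blast
  then have "is_cycle C"
    by (subst is_cycle_iff_cycle_graph[of r]) (auto simp: rooted_cycles_def cycle_graph_def)
  with p show "C \<in> hamilton_cycles G"
    by (auto simp: hamilton_cycles_def rooted_cycles_def subgraph_def cycle_graph_def)
qed

lemma finite_rooted_cycles:
  assumes "finite (verts G)"
  shows "finite (rooted_cycles G r)"
proof -
  have "rooted_cycles G r \<subseteq> {p. set p \<subseteq> verts G \<and> distinct p}"
    by (auto simp: rooted_cycles_def)
  then show ?thesis using finite_subset_distinct[OF assms] finite_subset by blast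
qed

text \<open>Double counting: the fibre of \<open>cycle_graph r\<close> over each Hamilton cycle is
  \<open>{p, rev p}\<close>. The two lists differ because a distinct list of length at least 2 has
  different first and last entries.\<close>

lemma card_rooted_cycles:
  assumes "finite (verts G)" "r \<in> verts G"
  shows "card (rooted_cycles G r) = 2 * num_hamilton_cycles G"
proof -
  let ?S = "rooted_cycles G r" and ?H = "hamilton_cycles G"
  have "card {q \<in> ?S. cycle_graph r q = C} = 2" if C: "C \<in> ?H" for C
  proof -
    obtain p where p: "p \<in> ?S" "C = cycle_graph r p"
      using C unfolding hamilton_cycles_eq_image[OF assms(2)] by blast
    then have p': "distinct p" "r \<notin> set p" "2 \<le> length p" "p \<noteq> []" by (auto simp: rooted_cycles_def)
    then have "rev p \<in> ?S"
      using p by (auto simp: rooted_cycles_def path_edges_cycle_rev)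
    moreover have "cycle_graph r q = C \<longleftrightarrow> q = p \<or> q = rev p" if "q \<in> ?S" for q
      unfolding p(2) using that p' by (intro cycle_graph_eq_iff) (auto simp: rooted_cycles_def)
    ultimately have "{q \<in> ?S. cycle_graph r q = C} = {p, rev p}"
      using p(1) by blast
    moreover have "p \<noteq> rev p"
    proof
      assume "p = rev p"
      then have "hd p = last p" by (metis hd_rev)
      then have "p ! 0 = p ! (length p - 1)" using p'(4) by (simp add: hd_conv_nth last_conv_nth)
      then show False using p' by (simp add: nth_eq_iff_index_eq)
    qed
    ultimately show ?thesis by simp
  qed
  then have "(\<Sum>C\<in>?H. card {q \<in> ?S. cycle_graph r q = C}) = 2 * card ?H" by simp
  moreover have "(\<Sum>C\<in>?H. card {q \<in> ?S. cycle_graph r q = C}) = card ?S"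
  proof -
    have "finite ?S" using finite_rooted_cycles[OF assms(1)] .
    moreover have "finite ?H" "cycle_graph r ` ?S \<subseteq> ?H"
      unfolding hamilton_cycles_eq_image[OF assms(2)] using \<open>finite ?S\<close> by auto
    ultimately show ?thesis
      using sum.group[of ?S ?H "cycle_graph r" "\<lambda>_. 1 :: nat"] by simp
  qed
  ultimately show ?thesis by (simp add: num_hamilton_cycles_def)
qed

section \<open>Contracting a zero in an alternating path\<close>

text \<open>Alternation is not written into the body; it follows from \<open>successively E\<close>
  whenever \<open>X\<close> and \<open>Y\<close> are independent sets. The condition on
  \<open>hd p\<close> and \<open>last p\<close> makes the path start and end among the ones.\<close>

definition alternating_paths :: "('a \<Rightarrow> 'a \<Rightarrow> bool) \<Rightarrow> 'a set \<Rightarrow> 'a set \<Rightarrow> 'a list set" where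
  "alternating_paths E X Y =
    {p. distinct p \<and> set p = X \<union> Y \<and> successively E p \<and> hd p \<in> Y \<and> last p \<in> Y}"

lemma finite_alternating_paths:
  assumes "finite X" "finite Y"
  shows "finite (alternating_paths E X Y)"
proof -
  have "alternating_paths E X Y \<subseteq> {p. set p \<subseteq> X \<union> Y \<and> distinct p}"
    by (auto simp: alternating_paths_def)
  then show ?thesis
    using finite_subset_distinct[of "X \<union> Y"] assms finite_subset by blast
qed

text \<open>Replacing \<open>y x y'\<close> by \<open>y\<close> is a bijection onto triples of a
  removed \<open>y'\<close>, a kept \<open>y\<close> and a shorter path. Since \<open>y\<close> and
  \<open>y'\<close> both lie in \<open>N\<close>, \<open>nested\<close> makes every vertex of
  \<open>X\<close> adjacent to both, so either may precede the rest of the path. The common value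
  \<open>K\<close> turns the sum over \<open>y'\<close> into a product.\<close>

lemma card_alternating_paths_insert:
  assumes fin: "finite X" "finite Y" and x: "x \<notin> X" "x \<notin> Y" and disj: "X \<inter> Y = {}"
    and sym: "\<And>u v. E u v \<Longrightarrow> E v u"
    and indepX: "\<And>u v. u \<in> insert x X \<Longrightarrow> v \<in> insert x X \<Longrightarrow> \<not> E u v"
    and indepY: "\<And>u v. u \<in> Y \<Longrightarrow> v \<in> Y \<Longrightarrow> \<not> E u v"
    and N: "N = {y \<in> Y. E x y}"
    and nested: "\<And>u y. u \<in> X \<Longrightarrow> y \<in> N \<Longrightarrow> E u y"
    and K: "\<And>y. y \<in> N \<Longrightarrow> card (alternating_paths E X (Y - {y})) = K"
  shows "card (alternating_paths E (insert x X) Y) = card N * (card N - 1) * K"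
proof -
  \<comment> \<open>the inverse of contracting \<open>y x y'\<close> to \<open>y\<close>\<close>
  define ins where "ins = (\<lambda>(y', y, p). takeWhile (\<lambda>z. z \<noteq> y) p @ [y, x, y'] @ tl (dropWhile (\<lambda>z. z \<noteq> y) p))"
  \<comment> \<open>The removed vertex \<open>y'\<close> comes first because the set of admissible
    shorter paths depends on it, whereas \<open>y\<close> ranges freely over the rest of
    \<open>N\<close>.\<close>
  define T where "T = (SIGMA y':N. (N - {y'}) \<times> alternating_paths E X (Y - {y'}))"
  have ins: "ins (y', y, as @ y # bs) = as @ [y, x, y'] @ bs" if "y \<notin> set as" for y y' as bs
  proof -
    have "takeWhile (\<lambda>z. z \<noteq> y) (as @ y # bs) = as" "dropWhile (\<lambda>z. z \<noteq> y) (as @ y # bs) = y # bs"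
      using that by (induction as) auto
    then show ?thesis by (simp add: ins_def)
  qed
  have split: "\<exists>as bs. p = as @ y # bs \<and> ins (y', y, p) = as @ [y, x, y'] @ bs \<and> y \<notin> set as
      \<and> x \<notin> set p \<and> y' \<notin> set p"
    if "(y', y, p) \<in> T" for y' y p
  proof -
    have p: "set p = X \<union> (Y - {y'})" "y \<in> set p" "y' \<in> Y"
      using that N by (auto simp: T_def alternating_paths_def)
    then obtain as bs where s: "p = as @ y # bs" "y \<notin> set as" by (metis split_list_first)
    moreover have "x \<notin> set p \<and> y' \<notin> set p" using p x disj by auto
    ultimately show ?thesis using ins[of y as y' bs] by blast
  qed
  have "inj_on ins T"
  proof (rule inj_onI)
    fix s t assume "s \<in> T" "t \<in> T" "ins s = ins t"
    moreover obtain a b p c d q where st: "s = (a, b, p)" "t = (c, d, q)" by (metis prod_cases3)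
    ultimately have t: "(a, b, p) \<in> T" "(c, d, q) \<in> T" and eq: "ins (a, b, p) = ins (c, d, q)"
      by auto
    obtain as bs where 1: "p = as @ b # bs" "ins (a, b, p) = (as @ [b]) @ x # a # bs" "x \<notin> set p"
      using split[OF t(1)] by auto
    obtain cs ds where 2: "q = cs @ d # ds" "ins (c, d, q) = (cs @ [d]) @ x # c # ds" "x \<notin> set q"
      using split[OF t(2)] by auto
    have "x \<notin> set (a # bs)" using t(1) 1 N x by (auto simp: T_def)
    moreover have "x \<notin> set (c # ds)" using t(2) 2 N x by (auto simp: T_def)
    \<comment> \<open>The new vertex \<open>x\<close> occurs exactly once in the expanded list, so
      the list can be split at \<open>x\<close> in only one way.\<close>
    ultimately have "as @ [b] = cs @ [d] \<and> a # bs = c # ds"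
      using eq 1 2 append_Cons_eq_iff[of x "as @ [b]" "a # bs" "cs @ [d]" "c # ds"] by auto
    then show "s = t" using 1 2 st by auto
  qed
  moreover have "ins ` T = alternating_paths E (insert x X) Y"
  proof (intro equalityI subsetI)
    fix q assume "q \<in> ins ` T"
    then obtain y' y p where t: "(y', y, p) \<in> T" and q: "q = ins (y', y, p)" by auto
    obtain as bs where s: "p = as @ y # bs" "q = as @ [y, x, y'] @ bs" "x \<notin> set p" "y' \<notin> set p"
      using split[OF t] q by auto
    have y: "y \<in> N" "y' \<in> N" "y \<noteq> y'" "y \<in> Y" "y' \<in> Y" "E x y" "E y x" "E x y'"
      and p: "distinct p" "set p = X \<union> (Y - {y'})" "successively E p" "hd p \<in> Y" "last p \<in> Y"
      using t N sym by (auto simp: T_def alternating_paths_def)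
    \<comment> \<open>The successor of \<open>y\<close> cannot be in the independent set
      \<open>Y\<close>, so it is in \<open>X\<close>, and \<open>nested\<close> supplies its edge to
      \<open>y'\<close>.\<close>
    have "E y' (hd bs)" if "bs \<noteq> []"
    proof -
      have "E y (hd bs)" using p(3) that by (auto simp: s successively_append_iff successively_Cons)
      then have "hd bs \<notin> Y" using indepY y by blast
      moreover have "hd bs \<in> set p" using that by (auto simp: s)
      ultimately show ?thesis using p(2) nested sym y by blast
    qed
    then have "successively E q"
      using p(3) y by (auto simp: s successively_append_iff successively_Cons)
    moreover have "distinct q" using p(1) s y x by auto
    moreover have "set q = insert x X \<union> Y"
    proof -
      have "set q = insert x (insert y' (set p))" by (auto simp: s)
      then show ?thesis using p(2) y by auto
    qed
    moreover have "hd q \<in> Y" "last q \<in> Y" using p(4,5) y by (auto simp: s hd_append split: if_splits)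
    ultimately show "q \<in> alternating_paths E (insert x X) Y"
      by (auto simp: alternating_paths_def)
  next
    fix q assume "q \<in> alternating_paths E (insert x X) Y"
    then have q: "distinct q" "set q = insert x X \<union> Y" "successively E q" "hd q \<in> Y" "last q \<in> Y"
      by (auto simp: alternating_paths_def)
    obtain us ws where s: "q = us @ x # ws" using q(2) by (metis UnI1 insertI1 split_list)
    have "us \<noteq> []" "ws \<noteq> []" using q(4,5) x by (auto simp: s)
    then obtain as y y' bs where s2: "us = as @ [y]" "ws = y' # bs"
      by (metis rev_exhaust list.exhaust)
    have E: "E y x" "E x y'" using q(3) by (auto simp: s s2 successively_append_iff successively_Cons)
    moreover have "y \<in> set q" "y' \<in> set q" by (auto simp: s s2)
    ultimately have y: "y \<in> Y" "y' \<in> Y" "y \<in> N" "y' \<in> N" using indepX q(2) N sym by blast+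
    have ne: "y \<noteq> y'" using q(1) by (auto simp: s s2)
    let ?p = "as @ y # bs"
    \<comment> \<open>The same exchange in the other direction: the successor of \<open>y'\<close>
      lies in \<open>X\<close> and is therefore adjacent to \<open>y\<close>.\<close>
    have "E y (hd bs)" if "bs \<noteq> []"
    proof -
      have "E y' (hd bs)" using q(3) that by (auto simp: s s2 successively_append_iff successively_Cons)
      then have "hd bs \<notin> Y" using indepY y by blast
      moreover have "hd bs \<in> set q" "hd bs \<noteq> x" using that q(1) by (auto simp: s s2)
      ultimately show ?thesis using q(2) nested sym y by blast
    qed
    then have "successively E ?p"
      using q(3) by (auto simp: s s2 successively_append_iff successively_Cons)
    moreover have "set ?p = X \<union> (Y - {y'})"
    proof -
      have "set ?p = set q - {x, y'}" using q(1) by (auto simp: s s2)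
      then show ?thesis using q(2) x y disj by auto
    qed
    moreover have "distinct ?p" using q(1) by (auto simp: s s2)
    moreover have "hd ?p \<in> Y - {y'}"
      using q(1,4) ne by (cases as) (auto simp: s s2)
    \<comment> \<open>If \<open>bs\<close> is empty, contraction changes the last vertex from
      \<open>y'\<close> to \<open>y\<close>, which is again in \<open>Y\<close>.\<close>
    moreover have "last ?p \<in> Y - {y'}"
    proof (cases "bs = []")
      case False
      then have "last bs \<in> set bs" by simp
      moreover have "y' \<notin> set bs" using q(1) by (simp add: s s2)
      ultimately show ?thesis using q(5) False by (auto simp: s s2)
    qed (use ne y in auto)
    ultimately have "(y', y, ?p) \<in> T" using y ne by (auto simp: T_def alternating_paths_def)
    moreover have "q = ins (y', y, ?p)" using q(1) by (subst ins) (auto simp: s s2)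
    ultimately show "q \<in> ins ` T" by blast
  qed
  ultimately have "card (alternating_paths E (insert x X) Y) = card T"
    by (metis card_image)
  also have "\<dots> = (\<Sum>y'\<in>N. (card N - 1) * K)"
  proof -
    have fN: "finite N" using N fin by auto
    have "card T = (\<Sum>y'\<in>N. card ((N - {y'}) \<times> alternating_paths E X (Y - {y'})))"
      unfolding T_def using fN fin by (intro card_SigmaI) (auto intro!: finite_alternating_paths)
    also have "\<dots> = (\<Sum>y'\<in>N. (card N - 1) * K)"
      using fN K by (intro sum.cong) (auto simp: card_cartesian_product)
    finally show ?thesis .
  qed
  finally show ?thesis by simp
qed

section \<open>Counting alternating paths in a chain graph\<close>

text \<open>\<open>chain_weight c bs\<close> reads the binary sequence from its end; \<open>c\<close> is the number of ones read
  so far, less one for every contracted zero.\<close>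

fun chain_weight :: "nat \<Rightarrow> bit list \<Rightarrow> nat" where
  "chain_weight c [] = (if c = 1 then 1 else 0)"
| "chain_weight c (x # bs) =
     (if x = 1 then chain_weight (Suc c) bs else c * (c - 1) * chain_weight (c - 1) bs)"

text \<open>Positions start at 0 as in the list \<open>b\<close>, so \<open>v i\<close> is the
  vertex carrying the bit \<open>b ! i\<close>. Working with \<open>v\<close> transfers the count to
  any graph isomorphic to \<open>chain_graph_of b\<close>, whatever its vertex type.\<close>

definition chain_enumeration :: "'a ugraph \<Rightarrow> bit list \<Rightarrow> (nat \<Rightarrow> 'a) \<Rightarrow> bool" where
  "chain_enumeration G b v \<longleftrightarrow>
     inj_on v {..<length b} \<and> verts G = v ` {..<length b} \<and>
     (\<forall>i<length b. \<forall>j<length b. {v i, v j} \<in> edges G \<longleftrightarrow>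
        (i < j \<and> b ! i = 0 \<and> b ! j = 1) \<or> (j < i \<and> b ! j = 0 \<and> b ! i = 1))"

text \<open>Induction strips positions from the end. The set \<open>J\<close> holds the positions
  beyond \<open>m\<close> of those ones that have not been contracted away; only its cardinality
  influences the count. Position 0 is left out, being reserved for the root.\<close>

lemma card_alternating_paths_chain:
  assumes en: "chain_enumeration G b v"
    and "m < length b" and "J \<subseteq> {m<..<length b}" and "\<forall>j\<in>J. b ! j = 1"
  shows "card (alternating_paths (\<lambda>u w. {u, w} \<in> edges G)
           (v ` {i \<in> {1..m}. b ! i = 0}) (v ` ({i \<in> {1..m}. b ! i = 1} \<union> J)))
         = chain_weight (card J) (rev (take m (tl b)))"
  using assms(2-)
proof (induction m arbitrary: J)
  \<comment> \<open>No zeros remain, and two ones are never adjacent, so a path has just one vertex;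
    the empty list fails \<open>hd p \<in> Y\<close>. This is the base clause of
    \<open>chain_weight\<close>.\<close>
  case 0
  have "J \<subseteq> {..<length b}" using 0 by auto
  then have inj: "inj_on v J" using en inj_on_subset by (auto simp: chain_enumeration_def)
  have nadj: "{u, w} \<notin> edges G" if "u \<in> v ` J" "w \<in> v ` J" for u w
  proof -
    obtain i j where ij: "u = v i" "w = v j" "i \<in> J" "j \<in> J" using \<open>u \<in> v ` J\<close> \<open>w \<in> v ` J\<close> by blast
    then have "i < length b" "j < length b" "b ! i = 1" "b ! j = 1" using 0 by auto
    then show ?thesis using en ij by (simp add: chain_enumeration_def)
  qed
  let ?P = "alternating_paths (\<lambda>u w. {u, w} \<in> edges G) {} (v ` J)"
  have short: "\<exists>j. p = [v j] \<and> J = {j}" if "p \<in> ?P" for p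
  proof -
    have p: "set p = v ` J" "successively (\<lambda>u w. {u, w} \<in> edges G) p" "hd p \<in> v ` J"
      using that by (auto simp: alternating_paths_def)
    then have "p \<noteq> []" by auto
    then obtain x q where q: "p = x # q" by (cases p) auto
    have "q = []"
    proof (rule ccontr)
      assume "q \<noteq> []"
      then obtain y r where "q = y # r" by (cases q) auto
      then show False using p nadj[of x y] q by (auto simp: successively_Cons)
    qed
    then have im: "v ` J = {x}" using p(1) q by auto
    then have "card J = 1" using card_image[OF inj] by simp
    then obtain j where "J = {j}" by (auto simp: card_1_singleton_iff)
    then show ?thesis using im q \<open>q = []\<close> by auto
  qed
  show ?case
  proof (cases "card J = 1")
    case True
    then obtain j where j: "J = {j}" by (auto simp: card_1_singleton_iff)
    then have "[v j] \<in> ?P" by (auto simp: alternating_paths_def)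
    moreover have "p = [v j]" if "p \<in> ?P" for p using short[OF that] j by auto
    ultimately have "?P = {[v j]}" by blast
    then show ?thesis using True by simp
  next
    case False
    have "p \<notin> ?P" for p
    proof
      assume "p \<in> ?P"
      from short[OF this] False show False by auto
    qed
    then have "?P = {}" by blast
    then show ?thesis using False by simp
  qed
next
  case (Suc m)
  let ?E = "\<lambda>u w. {u, w} \<in> edges G"
  let ?X = "{i \<in> {1..m}. b ! i = 0}" and ?O = "{i \<in> {1..m}. b ! i = 1}"
  have tk: "rev (take (Suc m) (tl b)) = b ! Suc m # rev (take m (tl b))"
    using Suc.prems(1) by (simp add: take_Suc_conv_app_nth nth_tl)
  have fin: "finite J" using Suc.prems finite_subset by blast
  have inj: "inj_on v {..<length b}" using en by (simp add: chain_enumeration_def)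
  have adj: "?E (v i) (v j) \<longleftrightarrow>
      (i < j \<and> b ! i = 0 \<and> b ! j = 1) \<or> (j < i \<and> b ! j = 0 \<and> b ! i = 1)"
    if "i < length b" "j < length b" for i j
    using en that by (simp add: chain_enumeration_def)
  show ?case
  proof (cases "b ! Suc m = 1")
    case True
    have "{i \<in> {1..Suc m}. b ! i = 0} = ?X"
      using True by (auto simp: le_Suc_eq)
    moreover have "{i \<in> {1..Suc m}. b ! i = 1} \<union> J = ?O \<union> insert (Suc m) J"
      using True by (auto simp: le_Suc_eq)
    \<comment> \<open>A one at position \<open>Suc m\<close> only moves into \<open>J\<close>; the
      vertex sets stay the same.\<close>
    moreover have "card (alternating_paths ?E (v ` ?X) (v ` (?O \<union> insert (Suc m) J)))
        = chain_weight (card (insert (Suc m) J)) (rev (take m (tl b)))"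
      using Suc.prems True by (intro Suc.IH) auto
    moreover have "card (insert (Suc m) J) = Suc (card J)"
      using fin Suc.prems by (subst card_insert_disjoint) auto
    ultimately show ?thesis using True by (simp add: tk)
  next
    case False
    then have 0: "b ! Suc m = 0" by simp
    have lt: "i < length b" if "i \<in> insert (Suc m) (?X \<union> ?O \<union> J)" for i
      using that Suc.prems by auto
    have bX: "b ! i = 0" if "i \<in> insert (Suc m) ?X" for i using that 0 by auto
    have bY: "b ! i = 1" if "i \<in> ?O \<union> J" for i using that Suc.prems by auto
    have X: "v ` {i \<in> {1..Suc m}. b ! i = 0} = insert (v (Suc m)) (v ` ?X)"
      using 0 by (auto simp: le_Suc_eq)
    have Y: "{i \<in> {1..Suc m}. b ! i = 1} \<union> J = ?O \<union> J"
      using 0 by (auto simp: le_Suc_eq)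
    have cJ: "card (v ` J) = card J"
      using lt by (intro card_image inj_on_subset[OF inj]) auto
    have "card (alternating_paths ?E (insert (v (Suc m)) (v ` ?X)) (v ` (?O \<union> J)))
        = card (v ` J) * (card (v ` J) - 1) * chain_weight (card J - 1) (rev (take m (tl b)))"
    proof (rule card_alternating_paths_insert)
      show "v (Suc m) \<notin> v ` ?X"
        using lt by (subst inj_on_image_mem_iff[OF inj]) auto
      show "v (Suc m) \<notin> v ` (?O \<union> J)"
        using lt Suc.prems by (subst inj_on_image_mem_iff[OF inj]) auto
      show "v ` ?X \<inter> v ` (?O \<union> J) = {}"
      proof -
        have "v ` ?X \<inter> v ` (?O \<union> J) = v ` (?X \<inter> (?O \<union> J))"
          using lt by (intro inj_on_image_Int[OF inj, symmetric]) auto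
        also have "?X \<inter> (?O \<union> J) = {}" using bY by fastforce
        finally show ?thesis by simp
      qed
      show "\<not> ?E u w" if "u \<in> insert (v (Suc m)) (v ` ?X)" "w \<in> insert (v (Suc m)) (v ` ?X)" for u w
      proof -
        have "u \<in> v ` insert (Suc m) ?X" "w \<in> v ` insert (Suc m) ?X" using that by auto
        then obtain i j where "u = v i" "w = v j" "i \<in> insert (Suc m) ?X" "j \<in> insert (Suc m) ?X"
          by blast
        then show ?thesis using adj[of i j] lt[of i] lt[of j] bX[of i] bX[of j] by auto
      qed
      show "\<not> ?E u w" if uw: "u \<in> v ` (?O \<union> J)" "w \<in> v ` (?O \<union> J)" for u w
      proof -
        obtain i j where "u = v i" "w = v j" "i \<in> ?O \<union> J" "j \<in> ?O \<union> J"
          using uw by blast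
        then show ?thesis using adj[of i j] lt[of i] lt[of j] bY[of i] bY[of j] by auto
      qed
      \<comment> \<open>A zero is adjacent only to later ones, so the neighbours of the last zero
        are exactly the vertices of \<open>J\<close>.\<close>
      have E: "?E (v (Suc m)) (v j) \<longleftrightarrow> j \<in> J" if "j \<in> ?O \<union> J" for j
        using adj[of "Suc m" j] lt[of j] bY[OF that] 0 that Suc.prems by auto
      then show "v ` J = {y \<in> v ` (?O \<union> J). ?E (v (Suc m)) y}" by blast
      show "?E u y" if uy: "u \<in> v ` ?X" "y \<in> v ` J" for u y
      proof -
        obtain i j where ij: "u = v i" "y = v j" "i \<in> ?X" "j \<in> J" using uy by blast
        moreover have "i < j" using ij Suc.prems by auto
        ultimately show ?thesis using adj[of i j] lt[of i] lt[of j] bX[of i] bY[of j] by auto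
      qed
      \<comment> \<open>Whichever one is removed, \<open>J\<close> loses a single element, so the
        induction hypothesis gives the same value for every choice.\<close>
      show "card (alternating_paths ?E (v ` ?X) (v ` (?O \<union> J) - {y}))
          = chain_weight (card J - 1) (rev (take m (tl b)))" if y: "y \<in> v ` J" for y
      proof -
        obtain j where j: "y = v j" "j \<in> J" using y by blast
        have "v ` (?O \<union> J) - v ` {j} = v ` (?O \<union> J - {j})"
          using lt j by (intro inj_on_image_set_diff[OF inj, symmetric]) auto
        moreover have "?O \<union> J - {j} = ?O \<union> (J - {j})" using j Suc.prems by auto
        ultimately have "v ` (?O \<union> J) - {y} = v ` (?O \<union> (J - {j}))" using j by simp
        moreover have "card (alternating_paths ?E (v ` ?X) (v ` (?O \<union> (J - {j}))))
            = chain_weight (card (J - {j})) (rev (take m (tl b)))"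
          using Suc.prems by (intro Suc.IH) auto
        moreover have "card (J - {j}) = card J - 1" using j by simp
        ultimately show ?thesis by simp
      qed
    qed (use fin in \<open>auto simp: insert_commute\<close>)
    then show ?thesis unfolding X Y tk using 0 cJ by simp
  qed
qed

section \<open>From alternating paths to Hamilton cycles\<close>

text \<open>The root is a zero preceding all other positions, hence adjacent to precisely the ones.
  The two closing edges at the root therefore say exactly that \<open>p\<close> starts and ends in
  ones.\<close>

lemma rooted_cycles_chain:
  assumes en: "chain_enumeration G b v" and len: "3 \<le> length b" and b0: "b ! 0 = 0"
  shows "rooted_cycles G (v 0) = alternating_paths (\<lambda>u w. {u, w} \<in> edges G)
    (v ` {i \<in> {1..length b - 1}. b ! i = 0}) (v ` {i \<in> {1..length b - 1}. b ! i = 1})"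
    (is "_ = alternating_paths ?E (v ` ?X) (v ` ?O)")
proof -
  have inj: "inj_on v {..<length b}" and V: "verts G = v ` {..<length b}"
    using en by (simp_all add: chain_enumeration_def)
  have idx: "{..<length b} = insert 0 (?X \<union> ?O)"
  proof (intro equalityI subsetI)
    fix i assume "i \<in> {..<length b}"
    then show "i \<in> insert 0 (?X \<union> ?O)" by (cases "i = 0"; cases "b ! i") auto
  qed (use len in auto)
  define W where "W = v ` (?X \<union> ?O)"
  have verts: "verts G = insert (v 0) W" unfolding V idx W_def by simp
  have v0: "v 0 \<notin> W"
    unfolding W_def using len by (subst inj_on_image_mem_iff[OF inj]) auto
  have root: "{v 0, u} \<in> edges G \<longleftrightarrow> u \<in> v ` ?O" if u: "u \<in> W" for u
  proof -
    obtain i where i: "u = v i" "i \<in> ?X \<union> ?O" using u unfolding W_def by blast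
    have "{v 0, v i} \<in> edges G \<longleftrightarrow> b ! i = 1"
    proof -
      have "0 < i" "i < length b" "0 < length b" using i(2) len by auto
      then show ?thesis using en b0 unfolding chain_enumeration_def by blast
    qed
    moreover have "v i \<in> v ` ?O \<longleftrightarrow> i \<in> ?O"
      using i(2) by (intro inj_on_image_mem_iff[OF inj]) auto
    ultimately show ?thesis using i by auto
  qed
  have card: "card (v ` {..<length b}) = length b" using card_image[OF inj] by simp
  show ?thesis
  proof (intro equalityI subsetI)
    fix p assume "p \<in> rooted_cycles G (v 0)"
    then have p: "distinct (v 0 # p)" "2 \<le> length p" "set (v 0 # p) = verts G"
        "path_edges (v 0 # p @ [v 0]) \<subseteq> edges G" by (simp_all add: rooted_cycles_def)
    then have ne: "p \<noteq> []" by auto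
    have "insert (v 0) (set p) = insert (v 0) W" "v 0 \<notin> set p"
      using p(1,3) unfolding verts by simp_all
    then have s: "set p = W" using v0 by (metis insert_ident)
    have "hd p \<in> set p" "last p \<in> set p" using ne by auto
    then have "hd p \<in> v ` ?O" "last p \<in> v ` ?O"
      using root[of "hd p"] root[of "last p"] s p(4) cycle_edges[OF ne, of "v 0"] by auto
    then show "p \<in> alternating_paths ?E (v ` ?X) (v ` ?O)"
      using p(1,4) s cycle_edges[OF ne, of "v 0"]
      by (simp add: alternating_paths_def successively_iff_path_edges W_def image_Un)
  next
    fix p assume "p \<in> alternating_paths ?E (v ` ?X) (v ` ?O)"
    then have p: "distinct p" "set p = W" "path_edges p \<subseteq> edges G"
        "hd p \<in> v ` ?O" "last p \<in> v ` ?O"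
      by (simp_all add: alternating_paths_def successively_iff_path_edges W_def image_Un)
    have d: "distinct (v 0 # p)" using p v0 by simp
    have s: "set (v 0 # p) = verts G" unfolding verts using p(2) by simp
    have l: "length (v 0 # p) = length b" using distinct_card[OF d] unfolding s V card by simp
    then have "2 \<le> length p" using len by simp
    then have ne: "p \<noteq> []" by auto
    then have "hd p \<in> W" "last p \<in> W" using p(2) by auto
    then have "path_edges (v 0 # p @ [v 0]) \<subseteq> edges G"
      using p root[of "hd p"] root[of "last p"] by (subst cycle_edges[OF ne]) (simp add: insert_commute)
    then show "p \<in> rooted_cycles G (v 0)" using d s \<open>2 \<le> length p\<close> by (simp add: rooted_cycles_def)
  qed
qed

lemma num_hamilton_cycles_chain:
  assumes en: "chain_enumeration G b v" and len: "3 \<le> length b" and b0: "b ! 0 = 0"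
  shows "2 * num_hamilton_cycles G = chain_weight 0 (rev (tl b))"
proof -
  have "verts G = v ` {..<length b}" using en by (simp add: chain_enumeration_def)
  then have "finite (verts G)" "v 0 \<in> verts G" using len by auto
  from card_rooted_cycles[OF this] have "2 * num_hamilton_cycles G = card (rooted_cycles G (v 0))"
    by simp
  \<comment> \<open>The induction starts with every position except the root still unread, so
    \<open>J\<close> is empty and the counter is 0.\<close>
  also have "\<dots> = chain_weight (card ({} :: nat set)) (rev (take (length b - 1) (tl b)))"
    unfolding rooted_cycles_chain[OF assms]
    using card_alternating_paths_chain[OF en, of "length b - 1" "{}"] len by simp
  finally show ?thesis by simp
qed

text \<open>A one is adjacent only to earlier zeros, so a one in first position would be isolated,
  while a Hamilton cycle gives every vertex a neighbour.\<close>

lemma hamiltonian_chain_first: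
  assumes en: "chain_enumeration G b v" and "b \<noteq> []" and "hamiltonian G"
  shows "b ! 0 = 0"
proof -
  have V: "verts G = v ` {..<length b}" using en by (simp add: chain_enumeration_def)
  then have "v 0 \<in> verts G" using assms(2) by auto
  then obtain p where p: "p \<in> rooted_cycles G (v 0)"
    using assms(3) hamilton_cycles_eq_image[of "v 0" G] by (auto simp: hamiltonian_def)
  then have ne: "p \<noteq> []" and s: "set p \<subseteq> verts G" by (auto simp: rooted_cycles_def)
  have e: "{v 0, hd p} \<in> edges G"
    using p cycle_edges[OF ne, of "v 0"] by (auto simp: rooted_cycles_def)
  have "hd p \<in> v ` {..<length b}" using s ne unfolding V by (metis hd_in_set subsetD)
  then obtain j where "j < length b" "hd p = v j" by blast
  then show ?thesis using en e assms(2) by (auto simp: chain_enumeration_def)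
qed

lemma graph_iso_imp_chain_enumeration:
  assumes "graph_iso G (chain_graph_of b)"
  obtains v where "chain_enumeration G b v"
proof -
  obtain f where f: "bij_betw f (verts G) {1..length b}"
    and e: "\<And>x y. x \<in> verts G \<Longrightarrow> y \<in> verts G \<Longrightarrow>
        {x, y} \<in> edges G \<longleftrightarrow> {f x, f y} \<in> edges (chain_graph_of b)"
    using assms by (auto simp: graph_iso_def chain_graph_of_def)
  \<comment> \<open>\<open>Suc\<close> translates list positions, counted from 0, into vertices of
    \<open>chain_graph_of b\<close>, counted from 1.\<close>
  let ?v = "inv_into (verts G) f \<circ> Suc"
  have S: "bij_betw Suc {..<length b} {1..length b}"
    by (simp add: bij_betw_def image_Suc_lessThan)
  have v: "bij_betw ?v {..<length b} (verts G)"
    using bij_betw_trans[OF S bij_betw_inv_into[OF f]] .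
  have fv: "f (?v i) = Suc i" if "i < length b" for i
    using bij_betw_inv_into_right[OF f, of "Suc i"] that by simp
  have "{?v i, ?v j} \<in> edges G \<longleftrightarrow>
      (i < j \<and> b ! i = 0 \<and> b ! j = 1) \<or> (j < i \<and> b ! j = 0 \<and> b ! i = 1)"
    if ij: "i < length b" "j < length b" for i j
  proof -
    have "?v i \<in> verts G" "?v j \<in> verts G" using ij v by (auto simp: bij_betw_def)
    then have "{?v i, ?v j} \<in> edges G \<longleftrightarrow> {Suc i, Suc j} \<in> edges (chain_graph_of b)"
      using e fv ij by metis
    also have "\<dots> \<longleftrightarrow> (i < j \<and> b ! i = 0 \<and> b ! j = 1) \<or> (j < i \<and> b ! j = 0 \<and> b ! i = 1)"
    proof
      assume "{Suc i, Suc j} \<in> edges (chain_graph_of b)"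
      then show "(i < j \<and> b ! i = 0 \<and> b ! j = 1) \<or> (j < i \<and> b ! j = 0 \<and> b ! i = 1)"
        by (auto simp: chain_graph_of_def doubleton_eq_iff)
    next
      assume *: "(i < j \<and> b ! i = 0 \<and> b ! j = 1) \<or> (j < i \<and> b ! j = 0 \<and> b ! i = 1)"
      have "{Suc k, Suc l} \<in> edges (chain_graph_of b)"
        if "k < l" "l < length b" "b ! k = 0" "b ! l = 1" for k l
        unfolding chain_graph_of_def using that
        by simp (intro exI[of _ "Suc k"] exI[of _ "Suc l"], simp)
      then show "{Suc i, Suc j} \<in> edges (chain_graph_of b)"
        using * ij by (metis insert_commute)
    qed
    finally show ?thesis .
  qed
  then have "chain_enumeration G b ?v"
    using v by (auto simp: chain_enumeration_def bij_betw_def)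
  then show ?thesis by (rule that)
qed

section \<open>Minimizing the weight of a binary sequence\<close>

lemma count_list_bit: "count_list bs (0 :: bit) + count_list bs 1 = length bs"
proof (induction bs)
  case (Cons x bs)
  then show ?case by (cases x) auto
qed simp

text \<open>Each one raises the counter and each zero lowers it, and a nonzero weight forces the
  final value 1. The truncated subtraction is harmless, since a zero read at counter 0 already makes
  the weight 0.\<close>

lemma chain_weight_balance:
  "chain_weight c bs \<noteq> 0 \<Longrightarrow> c + count_list bs 1 = count_list bs 0 + 1"
proof (induction c bs rule: chain_weight.induct)
  case (2 c x bs)
  then show ?case by (cases x) fastforce+
qed (auto split: if_splits)

text \<open>A nonzero factor \<open>c * (c - 1)\<close> has \<open>c \<ge> 2\<close>, so every zero
  contributes at least 2.\<close>

lemma chain_weight_ge: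
  "chain_weight c bs \<noteq> 0 \<Longrightarrow> 2 ^ count_list bs 0 \<le> chain_weight c bs"
proof (induction c bs rule: chain_weight.induct)
  case (2 c x bs)
  show ?case
  proof (cases "x = 0")
    case True
    with 2 have IH: "2 ^ count_list bs 0 \<le> chain_weight (c - 1) bs" and c: "2 \<le> c" by auto
    have "2 * 1 \<le> c * (c - 1)" using c by (intro mult_le_mono) auto
    with IH have "2 * 2 ^ count_list bs 0 \<le> c * (c - 1) * chain_weight (c - 1) bs"
      by (intro mult_le_mono) auto
    then show ?thesis using True by simp
  qed (use 2 in auto)
qed (auto split: if_splits)

text \<open>The counter cannot drop before the first zero, which is thus read at 3 or more and
  contributes at least 6. There must be such a zero, because the weight is nonzero only if the
  counter ends at 1.\<close>

lemma chain_weight_gt: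
  "chain_weight c bs \<noteq> 0 \<Longrightarrow> 3 \<le> c \<Longrightarrow> 2 ^ count_list bs 0 < chain_weight c bs"
proof (induction c bs rule: chain_weight.induct)
  case (2 c x bs)
  show ?case
  proof (cases "x = 0")
    case True
    with 2 have "2 ^ count_list bs 0 \<le> chain_weight (c - 1) bs" by (intro chain_weight_ge) auto
    moreover have "6 \<le> c * (c - 1)"
      using mult_le_mono[of 3 c 2 "c - 1"] "2.prems"(2) by simp
    ultimately have "6 * 2 ^ count_list bs 0 \<le> c * (c - 1) * chain_weight (c - 1) bs"
      by (intro mult_le_mono) auto
    moreover have "(2 :: nat) * 2 ^ count_list bs 0 < 6 * 2 ^ count_list bs 0" by simp
    ultimately have "2 * 2 ^ count_list bs 0 < c * (c - 1) * chain_weight (c - 1) bs" by linarith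
    then show ?thesis using True by simp
  qed (use 2 in auto)
qed (auto split: if_splits)

text \<open>A one read at counter 2 leads to 3, which \<open>chain_weight_gt\<close> excludes; a
  zero read at counter 1 gives weight 0. So the counter alternates between 2 and 1 until the list
  ends at 1. The induction is on length because it consumes two bits at a time.\<close>

lemma chain_weight_2_minimal:
  "chain_weight 2 bs = 2 ^ count_list bs 0 \<Longrightarrow> \<exists>k. bs = concat (replicate k [0, 1]) @ [0]"
proof (induction bs rule: length_induct)
  case (1 bs)
  have "bs \<noteq> []" using 1 by auto
  then obtain x cs where bs: "bs = x # cs" by (cases bs) auto
  have "x = 0"
  proof (rule ccontr)
    assume "x \<noteq> 0"
    then have "chain_weight 3 cs = 2 ^ count_list cs 0" using 1(2) bs by (simp add: numeral_3_eq_3)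
    then show False using chain_weight_gt[of 3 cs] by simp
  qed
  then have cs: "chain_weight 1 cs = 2 ^ count_list cs 0" using 1(2) bs by simp
  show ?case
  proof (cases cs)
    case Nil
    then show ?thesis using bs \<open>x = 0\<close> by (intro exI[of _ 0]) simp
  next
    case (Cons y ds)
    have y: "y = 1"
    proof (rule ccontr)
      assume "y \<noteq> 1"
      then show False using cs Cons by simp
    qed
    then have "chain_weight 2 ds = 2 ^ count_list ds 0" using cs Cons by (simp add: numeral_2_eq_2)
    then have "\<exists>k. ds = concat (replicate k [0, 1]) @ [0]"
      using 1(1)[rule_format, of ds] bs Cons by simp
    then obtain k where "ds = concat (replicate k [0, 1]) @ [0]" by blast
    then show ?thesis using bs Cons y \<open>x = 0\<close> by (intro exI[of _ "Suc k"]) simp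
  qed
qed

text \<open>A zero read at counter 0 or 1 contributes the factor 0, so the first two bits read must
  be ones.\<close>

lemma chain_weight_0_minimal:
  assumes "chain_weight 0 bs = 2 ^ count_list bs 0" and "2 \<le> length bs"
  shows "\<exists>k. bs = [1, 1] @ concat (replicate k [0, 1]) @ [0]"
proof -
  obtain x y cs where bs: "bs = x # y # cs"
    using assms(2) by (cases bs; cases "tl bs") auto
  have x: "x = 1" using assms(1) bs by (cases x) auto
  have y: "y = 1" using assms(1) bs x by (cases y) auto
  have "chain_weight 2 cs = 2 ^ count_list cs 0"
    using assms(1) bs x y by (simp add: numeral_2_eq_2)
  then show ?thesis using chain_weight_2_minimal bs x y by auto
qed

lemma chain_weight_extremal: "chain_weight 2 (concat (replicate k [0, 1]) @ [0]) = 2 ^ Suc k"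
  by (induction k) (auto simp: numeral_2_eq_2)

lemma length_concat_replicate_pair: "length (concat (replicate k [x, y])) = 2 * k"
  by (induction k) auto

lemma graph_iso_refl: "graph_iso G G"
  unfolding graph_iso_def by (intro exI[of _ id]) auto

lemma chain_graph_chain_graph_of: "chain_graph (chain_graph_of b)"
  unfolding chain_graph_def simple_graph_def using graph_iso_refl[of "chain_graph_of b"]
  by (auto simp: chain_graph_of_def)

lemma graph_order_iso: "graph_iso G (chain_graph_of b) \<Longrightarrow> graph_order G = length b"
  unfolding graph_iso_def graph_order_def
  by (auto dest!: bij_betw_same_card simp: chain_graph_of_def)

theorem theorem5p3:
  fixes h n :: nat
  assumes "h \<ge> 2" and "n = 2 * h"
  shows "(chain_graph (extremal_graph h) \<and> graph_order (extremal_graph h) = n \<and>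
          hamiltonian (extremal_graph h) \<and>
          num_hamilton_cycles (extremal_graph h) = 2 ^ (h - 2)) \<and>
         (\<forall>G :: 'a ugraph. chain_graph G \<and> graph_order G = n \<and> hamiltonian G \<longrightarrow>
            2 ^ (h - 2) \<le> num_hamilton_cycles G \<and>
            (num_hamilton_cycles G = 2 ^ (h - 2) \<longrightarrow> graph_iso G (extremal_graph h)))"
proof -
  define e :: "bit list" where "e = [0, 0] @ concat (replicate (h - 2) [1, 0]) @ [1, 1]"
  have eg: "extremal_graph h = chain_graph_of e" by (simp add: extremal_graph_def e_def)
  \<comment> \<open>The weight has \<open>h - 1\<close> factors and counts each cycle twice; this
    identity removes the doubling.\<close>
  have pow: "(2 :: nat) ^ (h - 1) = 2 * 2 ^ (h - 2)"
    using assms(1) by (metis Suc_1 Suc_diff_le diff_Suc_Suc power_Suc One_nat_def)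
  have le: "length e = n"
    using assms by (simp add: e_def length_concat_replicate_pair)
  obtain v where v: "chain_enumeration (chain_graph_of e) e v"
    using graph_iso_imp_chain_enumeration graph_iso_refl by blast
  \<comment> \<open>\<open>tl\<close> drops the root, and reversal turns the blocks
    \<open>[1, 0]\<close> into \<open>[0, 1]\<close>.\<close>
  have "rev (tl e) = [1, 1] @ concat (replicate (h - 2) [0, 1]) @ [0]"
    by (simp add: e_def rev_concat)
  then have "chain_weight 0 (rev (tl e)) = 2 ^ Suc (h - 2)"
    using chain_weight_extremal[of "h - 2"] by (simp add: numeral_2_eq_2)
  then have num: "num_hamilton_cycles (chain_graph_of e) = 2 ^ (h - 2)"
    using num_hamilton_cycles_chain[OF v] le assms by (simp add: e_def)
  then have "hamilton_cycles (chain_graph_of e) \<noteq> {}"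
    unfolding num_hamilton_cycles_def by (metis card.empty power_not_zero zero_neq_numeral)
  then have 1: "chain_graph (extremal_graph h) \<and> graph_order (extremal_graph h) = n \<and>
      hamiltonian (extremal_graph h) \<and> num_hamilton_cycles (extremal_graph h) = 2 ^ (h - 2)"
    using num le graph_order_iso[OF graph_iso_refl, of e]
    by (simp add: eg chain_graph_chain_graph_of hamiltonian_def)
  have 2: "2 ^ (h - 2) \<le> num_hamilton_cycles G \<and>
      (num_hamilton_cycles G = 2 ^ (h - 2) \<longrightarrow> graph_iso G (extremal_graph h))"
    if G: "chain_graph G" "graph_order G = n" "hamiltonian G" for G :: "'a ugraph"
  proof -
    obtain b where iso: "graph_iso G (chain_graph_of b)" using G(1) by (auto simp: chain_graph_def)
    have len: "length b = 2 * h" using graph_order_iso[OF iso] G(2) assms(2) by simp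
    obtain w where w: "chain_enumeration G b w" using graph_iso_imp_chain_enumeration[OF iso] .
    have b0: "b ! 0 = 0" using hamiltonian_chain_first[OF w _ G(3)] len assms(1) by fastforce
    define bs where "bs = rev (tl b)"
    have b: "b = 0 # rev bs" using b0 len assms(1) by (cases b) (auto simp: bs_def)
    have num: "2 * num_hamilton_cycles G = chain_weight 0 bs"
      using num_hamilton_cycles_chain[OF w _ b0] len assms(1) by (simp add: bs_def)
    have "verts G = w ` {..<length b}" using w by (simp add: chain_enumeration_def)
    then have V: "finite (verts G)" "w 0 \<in> verts G" using len assms(1) by auto
    \<comment> \<open>Finiteness is essential here: \<open>card\<close> is 0 on infinite sets, so
      nonemptiness alone would not make the count nonzero.\<close>
    have "finite (hamilton_cycles G)"
      unfolding hamilton_cycles_eq_image[OF V(2)] using finite_rooted_cycles[OF V(1)] by simp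
    then have "num_hamilton_cycles G \<noteq> 0"
      using G(3) by (simp add: num_hamilton_cycles_def hamiltonian_def)
    then have nz: "chain_weight 0 bs \<noteq> 0" using num by simp
    \<comment> \<open>The \<open>2 * h - 1\<close> bits other than the root contain one more one
      than zeros.\<close>
    have z: "count_list bs 0 = h - 1"
      using chain_weight_balance[OF nz] count_list_bit[of bs] len b by simp
    have "2 ^ (h - 1) \<le> chain_weight 0 bs" using chain_weight_ge[OF nz] z by simp
    then have "2 ^ (h - 2) \<le> num_hamilton_cycles G" using num pow by simp
    moreover have "graph_iso G (extremal_graph h)" if "num_hamilton_cycles G = 2 ^ (h - 2)"
    proof -
      have "chain_weight 0 bs = 2 ^ count_list bs 0" using that num pow z by simp
      moreover have "2 \<le> length bs" using len assms(1) b by simp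
      ultimately obtain k where k: "bs = [1, 1] @ concat (replicate k [0, 1]) @ [0]"
        using chain_weight_0_minimal by blast
      \<comment> \<open>Comparing lengths determines \<open>k\<close>: besides the \<open>k\<close>
        pairs there are the root, two ones and a zero.\<close>
      then have "2 * h = 2 * k + 4" using len b by (simp add: length_concat_replicate_pair)
      then have "k = h - 2" by simp
      then have "b = e" unfolding b k e_def by (simp add: rev_concat)
      then show ?thesis using iso eg by simp
    qed
    ultimately show ?thesis by blast
  qed
  show ?thesis using 1 2 by blast
qed

end
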